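(* Let $q\ge2$ be an integer, $\beta>0$, and let $(V,\mathcal{E})$, $U\subset V$, $S$, $\mathcal{I}$, $\preceq$ and $\hat\mu$ be as in the context. For every $x\in V$, every $a\in S$ and every $\omega\in\mathcal{I}^{\mathcal{E}}$, $$\big|\{\sigma\in S^V:\ \omega\preceq\sigma,\ \sigma_u=0\ \forall u\in U,\ \sigma_x=a\}\big|\ \le\ \big|\{\sigma\in S^V:\ \omega\preceq\sigma,\ \sigma_u=0\ \forall u\in U,\ \sigma_x=0\}\big|.$$ Equivalently, $$\hat\mu\big(\sigma:\ \sigma_x=a,\ \omega\preceq\sigma\big)\ \le\ \hat\mu\big(\sigma:\ \sigma_x=0,\ \omega\preceq\sigma\big).$$
   Context: Setting: $(V,\mathcal{E})$ is a finite non-oriented graph without loops or multiple edges, not necessarily connected; $U\subset V$ is a non-empty set such that no edge of $\mathcal{E}$ has both endpoints in $U$. Spin set: $S=\{2\pi i/q:\ i=0,\dots,q-1\}$. For an angle $a$, $W(a)=e^{-\beta(1-\cos a)}$ (so $W(\sigma_x-\sigma_y)$ makes sense for differences of spins, taken mod $2\pi$), and $\mathcal{I}=\{W(a):a\in S\}\subset(0,1]$. Compatibility: for $\omega\in\mathcal{I}^{\mathcal{E}}$ and $\sigma\in S^V$, $\omega\preceq\sigma$ means $\omega_{\langle xy\rangle}\le W(\sigma_x-\sigma_y)$ for every edge $\langle xy\rangle\in\mathcal{E}$. $\hat\mu$ is the uniform probability on the configurations in $S^V$ that vanish on $U$: $\hat\mu(\sigma)=q^{-|V\setminus U|}\,\mathbf{1}[\sigma_u=0\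 \forall u\in U]$. *)

theory Defs
  imports "HOL-Probability.Probability" "HOL-Library.Ramsey"
begin

text \<open>
  A finite graph without loops or multiple edges is a pair of a finite vertex set \<open>V\<close> and an
  edge set \<open>E \<subseteq> nsets V 2\<close>, so that an edge is an unordered pair \<open>{x, y}\<close> with \<open>x \<noteq> y\<close>.
  The index sets \<open>V\<close> and \<open>E\<close> of spin and edge configurations are explicit, so these are
  extensional functions, i.e. \<^const>\<open>undefined\<close> off \<open>V\<close> and \<open>E\<close>; thus \<open>S\<^sup>V\<close> is a finite set
  and cardinalities have their usual meaning.
\<close>

definition spins :: "nat \<Rightarrow> real set" where
  "spins q = {2 * pi * real i / real q | i. i < q}"

definition W :: "real \<Rightarrow> real \<Rightarrow> real" where
  "W \<beta> a = exp (- \<beta> * (1 - cos a))"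

definition weights :: "nat \<Rightarrow> real \<Rightarrow> real set" where
  "weights q \<beta> = W \<beta> ` spins q"

definition configs :: "nat \<Rightarrow> 'v set \<Rightarrow> ('v \<Rightarrow> real) set" where
  "configs q V = V \<rightarrow>\<^sub>E spins q"

definition edge_configs :: "nat \<Rightarrow> real \<Rightarrow> 'v set set \<Rightarrow> ('v set \<Rightarrow> real) set" where
  "edge_configs q \<beta> E = E \<rightarrow>\<^sub>E weights q \<beta>"

text \<open>
  Spin differences need no reduction modulo \<open>2 * pi\<close>, and the order of the endpoints of an edge
  is immaterial, because \<open>W \<beta>\<close> is even and \<open>2 * pi\<close>-periodic.
\<close>

definition compatible ::
  "real \<Rightarrow> 'v set set \<Rightarrow> ('v set \<Rightarrow> real) \<Rightarrow> ('v \<Rightarrow> real) \<Rightarrow> bool" where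
  "compatible \<beta> E \<omega> \<sigma> \<longleftrightarrow> (\<forall>x y. {x, y} \<in> E \<longrightarrow> \<omega> {x, y} \<le> W \<beta> (\<sigma> x - \<sigma> y))"

definition mu_hat :: "nat \<Rightarrow> 'v set \<Rightarrow> 'v set \<Rightarrow> ('v \<Rightarrow> real) pmf" where
  "mu_hat q V U = pmf_of_set {\<sigma> \<in> configs q V. \<forall>u\<in>U. \<sigma> u = 0}"

text \<open>
  \<^const>\<open>pmf_of_set\<close> is only meaningful for finite nonempty sets; the following shows that it is
  applied to such a set, and gives the explicit mass function \<open>q\<^bsup>-|V \ U|\<^esup> 1[\<sigma> = 0 on U]\<close>.
\<close>

lemma spins_eq_image: "spins q = (\<lambda>i. 2 * pi * real i / real q) ` {..<q}"
  by (auto simp: spins_def)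

lemma finite_spins: "finite (spins q)"
  by (simp add: spins_eq_image)

lemma card_spins: "card (spins q) = q"
  unfolding spins_eq_image
  by (cases "q = 0") (simp_all add: card_image inj_on_def)

lemma zero_in_spins: "q > 0 \<Longrightarrow> 0 \<in> spins q"
  unfolding spins_eq_image by (rule image_eqI[of _ _ 0]) simp_all

lemma vanishing_configs_eq_PiE:
  assumes "q > 0" "U \<subseteq> V"
  shows "{\<sigma> \<in> configs q V. \<forall>u\<in>U. \<sigma> u = 0} = PiE V (\<lambda>x. if x \<in> U then {0} else spins q)"
proof -
  have "0 \<in> spins q" using assms(1) by (rule zero_in_spins)
  then show ?thesis
    using assms(2) by (intro set_eqI) (auto simp: configs_def PiE_iff split: if_splits)
qed

lemma pmf_mu_hat:
  assumes "q > 0" "finite V" "U \<subseteq> V" "\<sigma> \<in> configs q V"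
  shows "pmf (mu_hat q V U) \<sigma> = (if \<forall>u\<in>U. \<sigma> u = 0 then 1 / real q ^ card (V - U) else 0)"
proof -
  let ?A = "{\<sigma> \<in> configs q V. \<forall>u\<in>U. \<sigma> u = 0}"
  have "card ?A = (\<Prod>x\<in>V. if x \<in> U then 1 else q)"
    unfolding vanishing_configs_eq_PiE[OF assms(1,3)] card_PiE[OF assms(2)]
    by (intro prod.cong) (simp_all add: card_spins)
  also have "\<dots> = q ^ card (V - U)"
    using assms(2) by (simp add: prod.If_cases Diff_eq)
  finally have card: "card ?A = q ^ card (V - U)" .
  then have "card ?A > 0" using assms(1) by simp
  then have "finite ?A" "?A \<noteq> {}" unfolding card_gt_0_iff by (rule conjunct2, rule conjunct1)
  then show ?thesis using assms(4) card
    by (simp add: mu_hat_def indicator_def)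
qed

end

theory Submission
  imports Defs
begin

text \<open>
  The circle carries the reflection \<open>s \<mapsto> a - s\<close>, which exchanges \<open>0\<close> and \<open>a\<close>; its axis cuts the
  circle into two open half circles, one around each of the two points. On each half circle the
  reflection exchanges nearer and farther: two points of the same half are closer to each other
  than either is to the mirror image of the other (\<open>cos_diff_reflect\<close>). Hence, once all spins are
  known up to reflection, what remains is a ferromagnetic Ising model with hard constraints: an
  edge either forces its endpoints onto the same side (it is called rigid) or lets them choose
  their sides independently.

  Given a compatible \<open>\<sigma>\<close> with \<open>\<sigma> x = a\<close>, reflect all spins in the cluster of \<open>x\<close> formed by the rigid
  edges. The result is again compatible, because edges inside the cluster are moved isometrically
  and edges leaving it are not rigid (\<open>compatible_flip\<close>). The cluster of \<open>x\<close> stays in the half circle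
  around \<open>a\<close>, so it avoids \<open>U\<close>, where the spins are \<open>0\<close> (\<open>cluster_same_side\<close>). Finally, the flip does
  not change which edges are rigid (\<open>rigid_flip\<close>), so it is undone by a second flip and is
  injective; it maps the configurations with \<open>\<sigma> x = a\<close> into those with \<open>\<sigma> x = 0\<close>.
\<close>

text \<open>
  For \<open>a\<close> and \<open>s\<close> in \<open>{0..<2 * pi}\<close> this is the representative of \<open>a - s\<close> modulo \<open>2 * pi\<close> in
  that interval, so that the reflection maps spins to spins.
\<close>

definition reflect :: "real \<Rightarrow> real \<Rightarrow> real" where
  "reflect a s = (if s \<le> a then a - s else a - s + 2 * pi)"

lemma W_minus: "W \<beta> (- t) = W \<beta> t"
  by (simp add: W_def)

lemma W_le_iff: "\<beta> > 0 \<Longrightarrow> W \<beta> s \<le> W \<beta> t \<longleftrightarrow> cos s \<le> cos t"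
  by (simp add: W_def)

lemma W_add_2pi: "W \<beta> (t + 2 * pi) = W \<beta> t" "W \<beta> (t - 2 * pi) = W \<beta> t"
  by (simp_all add: W_def cos_add cos_diff)

lemma W_reflect_left: "W \<beta> (reflect a s - t) = W \<beta> (a - s - t)"
  using W_add_2pi(1)[of \<beta> "a - s - t"] by (simp add: reflect_def algebra_simps)

lemma W_reflect_right: "W \<beta> (s - reflect a t) = W \<beta> (a - s - t)"
  using W_minus[of \<beta> "reflect a t - s"] by (simp add: W_reflect_left algebra_simps)

lemma W_reflect_both: "W \<beta> (reflect a s - reflect a t) = W \<beta> (s - t)"
  using W_minus[of \<beta> "s - t"] W_add_2pi(2)[of \<beta> "t - s"]
  by (simp add: W_reflect_left) (simp add: reflect_def algebra_simps)

lemma spins_bounds: "s \<in> spins q \<Longrightarrow> 0 \<le> s \<and> s < 2 * pi"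
  by (auto simp: spins_def field_simps)

lemma reflect_reflect: "0 \<le> s \<Longrightarrow> s < 2 * pi \<Longrightarrow> reflect a (reflect a s) = s"
  by (auto simp: reflect_def)

lemma reflect_in_spins:
  assumes "a \<in> spins q" "s \<in> spins q"
  shows "reflect a s \<in> spins q"
proof -
  obtain i j where ij: "i < q" "j < q" "a = 2 * pi * real i / real q" "s = 2 * pi * real j / real q"
    using assms by (auto simp: spins_def)
  have le: "s \<le> a \<longleftrightarrow> j \<le> i"
    using ij by (simp add: divide_le_cancel)
  show ?thesis
  proof (cases "j \<le> i")
    case True
    then have "reflect a s = 2 * pi * real (i - j) / real q"
      using le ij by (simp add: reflect_def of_nat_diff diff_divide_distrib right_diff_distrib)
    moreover have "i - j < q" using ij by simp
    ultimately show ?thesis by (auto simp: spins_def)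
  next
    case False
    then have "reflect a s = a - s + 2 * pi"
      using le by (simp add: reflect_def)
    also have "\<dots> = 2 * pi * real (i + q - j) / real q"
      using ij by (simp add: of_nat_diff field_simps)
    finally have "reflect a s = 2 * pi * real (i + q - j) / real q" .
    moreover have "i + q - j < q" using False ij by simp
    ultimately show ?thesis by (auto simp: spins_def)
  qed
qed

text \<open>
  The points \<open>s\<close> with \<open>sin (s - a / 2) > 0\<close> form the open half circle around \<open>a\<close>, those with
  negative sine the one around \<open>0\<close>.
\<close>

lemma cos_diff_reflect:
  fixes s t a :: real
  shows "cos (s - t) - cos (a - s - t) = 2 * sin (s - a / 2) * sin (t - a / 2)"
proof -
  have "cos (a - s - t) = cos ((s - a / 2) + (t - a / 2))"
    using cos_minus[of "a - s - t"] by (simp add: algebra_simps)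
  moreover have "cos (s - t) = cos ((s - a / 2) - (t - a / 2))"
    by simp
  ultimately show ?thesis
    by (simp only: cos_add cos_diff)
qed

text \<open>
  Rigid edges are those that would be violated if the spin at one endpoint alone were reflected.
  For compatible \<open>\<sigma>\<close> they are the edges whose constraint couples the sides of the two endpoints.
\<close>

definition rigid ::
  "real \<Rightarrow> 'v set set \<Rightarrow> ('v set \<Rightarrow> real) \<Rightarrow> real \<Rightarrow> ('v \<Rightarrow> real) \<Rightarrow> ('v \<times> 'v) set" where
  "rigid \<beta> E \<omega> a \<sigma> = {(u, v). {u, v} \<in> E \<and> W \<beta> (reflect a (\<sigma> u) - \<sigma> v) < \<omega> {u, v}}"

definition cluster ::
  "real \<Rightarrow> 'v set set \<Rightarrow> ('v set \<Rightarrow> real) \<Rightarrow> real \<Rightarrow> 'v \<Rightarrow> ('v \<Rightarrow> real) \<Rightarrow> 'v set" where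
  "cluster \<beta> E \<omega> a x \<sigma> = (rigid \<beta> E \<omega> a \<sigma>)\<^sup>* `` {x}"

definition flip ::
  "real \<Rightarrow> 'v set set \<Rightarrow> ('v set \<Rightarrow> real) \<Rightarrow> real \<Rightarrow> 'v \<Rightarrow> ('v \<Rightarrow> real) \<Rightarrow> 'v \<Rightarrow> real" where
  "flip \<beta> E \<omega> a x \<sigma> v = (if v \<in> cluster \<beta> E \<omega> a x \<sigma> then reflect a (\<sigma> v) else \<sigma> v)"

lemma rigid_sym: "(u, v) \<in> rigid \<beta> E \<omega> a \<sigma> \<Longrightarrow> (v, u) \<in> rigid \<beta> E \<omega> a \<sigma>"
  by (simp add: rigid_def W_reflect_left insert_commute algebra_simps)

lemma cluster_refl: "x \<in> cluster \<beta> E \<omega> a x \<sigma>"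
  by (simp add: cluster_def)

lemma cluster_closed:
  assumes "(u, v) \<in> rigid \<beta> E \<omega> a \<sigma>"
  shows "u \<in> cluster \<beta> E \<omega> a x \<sigma> \<longleftrightarrow> v \<in> cluster \<beta> E \<omega> a x \<sigma>"
  using assms rigid_sym[OF assms]
  by (auto simp: cluster_def intro: rtrancl_into_rtrancl)

lemma cluster_subset:
  assumes "E \<subseteq> nsets V 2" "x \<in> V"
  shows "cluster \<beta> E \<omega> a x \<sigma> \<subseteq> V"
proof
  fix v assume "v \<in> cluster \<beta> E \<omega> a x \<sigma>"
  then have "(x, v) \<in> (rigid \<beta> E \<omega> a \<sigma>)\<^sup>*" by (simp add: cluster_def)
  then show "v \<in> V"
    by (induction rule: rtrancl_induct) (use assms in \<open>auto simp: rigid_def nsets_def\<close>)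
qed

lemma flip_in_configs:
  assumes "E \<subseteq> nsets V 2" "x \<in> V" "a \<in> spins q" "\<sigma> \<in> configs q V"
  shows "flip \<beta> E \<omega> a x \<sigma> \<in> configs q V"
  using assms(4) cluster_subset[OF assms(1,2), of \<beta> \<omega> a \<sigma>] reflect_in_spins[OF assms(3)]
  by (auto simp: configs_def flip_def PiE_iff extensional_def)

text \<open>
  A rigid edge that is satisfied brings its endpoints closer to each other than to each other's
  mirror images, so both lie in the same open half circle; this propagates along the cluster.
\<close>

lemma cluster_same_side:
  assumes "\<beta> > 0" "compatible \<beta> E \<omega> \<sigma>" "sin (\<sigma> x - a / 2) > 0" "v \<in> cluster \<beta> E \<omega> a x \<sigma>"
  shows "sin (\<sigma> v - a / 2) > 0"
proof -
  have "(x, v) \<in> (rigid \<beta> E \<omega> a \<sigma>)\<^sup>*"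
    using assms(4) by (simp add: cluster_def)
  then show ?thesis
  proof (induction rule: rtrancl_induct)
    case base
    show ?case by (fact assms(3))
  next
    case (step y z)
    have "\<omega> {y, z} \<le> W \<beta> (\<sigma> y - \<sigma> z)" "W \<beta> (a - \<sigma> y - \<sigma> z) < \<omega> {y, z}"
      using step.hyps(2) assms(2) by (auto simp: rigid_def compatible_def W_reflect_left)
    then have "\<not> W \<beta> (\<sigma> y - \<sigma> z) \<le> W \<beta> (a - \<sigma> y - \<sigma> z)"
      by linarith
    then have "0 < cos (\<sigma> y - \<sigma> z) - cos (a - \<sigma> y - \<sigma> z)"
      by (simp add: W_le_iff[OF assms(1)])
    then show ?case
      using step.IH by (simp add: cos_diff_reflect zero_less_mult_iff)
  qed
qed

lemma compatible_flip:
  assumes "compatible \<beta> E \<omega> \<sigma>"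
  shows "compatible \<beta> E \<omega> (flip \<beta> E \<omega> a x \<sigma>)"
  unfolding compatible_def
proof (intro allI impI)
  fix u v assume e: "{u, v} \<in> E"
  have c: "\<omega> {u, v} \<le> W \<beta> (\<sigma> u - \<sigma> v)"
    using assms e by (simp add: compatible_def)
  show "\<omega> {u, v} \<le> W \<beta> (flip \<beta> E \<omega> a x \<sigma> u - flip \<beta> E \<omega> a x \<sigma> v)"
  proof (cases "u \<in> cluster \<beta> E \<omega> a x \<sigma> \<longleftrightarrow> v \<in> cluster \<beta> E \<omega> a x \<sigma>")
    case True
    then show ?thesis using c by (simp add: flip_def W_reflect_both)
  next
    case False
    then have "(u, v) \<notin> rigid \<beta> E \<omega> a \<sigma>"
      using cluster_closed by metis
    then have "\<omega> {u, v} \<le> W \<beta> (a - \<sigma> u - \<sigma> v)"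
      using e by (simp add: rigid_def W_reflect_left)
    then show ?thesis using False by (auto simp: flip_def W_reflect_left W_reflect_right)
  qed
qed

text \<open>
  Edges inside or outside the cluster keep their relative position. An edge leaving the cluster is
  not rigid before the flip; afterwards, reflecting one endpoint would only restore the original
  distance, which is allowed because \<open>\<sigma>\<close> is compatible.
\<close>

lemma rigid_flip:
  assumes "compatible \<beta> E \<omega> \<sigma>"
  shows "rigid \<beta> E \<omega> a (flip \<beta> E \<omega> a x \<sigma>) = rigid \<beta> E \<omega> a \<sigma>"
proof -
  have "(u, v) \<in> rigid \<beta> E \<omega> a (flip \<beta> E \<omega> a x \<sigma>) \<longleftrightarrow> (u, v) \<in> rigid \<beta> E \<omega> a \<sigma>" for u v
  proof (cases "u \<in> cluster \<beta> E \<omega> a x \<sigma> \<longleftrightarrow> v \<in> cluster \<beta> E \<omega> a x \<sigma>")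
    case True
    then show ?thesis
      by (auto simp: rigid_def flip_def W_reflect_both)
  next
    case False
    then have "(u, v) \<notin> rigid \<beta> E \<omega> a \<sigma>"
      using cluster_closed by metis
    moreover have "W \<beta> (reflect a (flip \<beta> E \<omega> a x \<sigma> u) - flip \<beta> E \<omega> a x \<sigma> v) = W \<beta> (\<sigma> u - \<sigma> v)"
    proof (cases "u \<in> cluster \<beta> E \<omega> a x \<sigma>")
      case True
      then show ?thesis using False W_reflect_right[of \<beta> "reflect a (\<sigma> u)" a "reflect a (\<sigma> v)"]
        W_reflect_left[of \<beta> a "reflect a (\<sigma> u)" "\<sigma> v"] W_reflect_right[of \<beta> "a - \<sigma> v" a "\<sigma> u"]
        W_minus[of \<beta> "\<sigma> u - \<sigma> v"]
        by (simp add: flip_def algebra_simps)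
    next
      case False': False
      then show ?thesis using False by (simp add: flip_def W_reflect_both)
    qed
    moreover have "\<omega> {u, v} \<le> W \<beta> (\<sigma> u - \<sigma> v)" if "{u, v} \<in> E"
      using assms that by (simp add: compatible_def)
    ultimately show ?thesis
      by (auto simp: rigid_def not_less[symmetric])
  qed
  then show ?thesis by auto
qed

lemma flip_flip:
  assumes "compatible \<beta> E \<omega> \<sigma>" "E \<subseteq> nsets V 2" "x \<in> V" "\<sigma> \<in> configs q V"
  shows "flip \<beta> E \<omega> a x (flip \<beta> E \<omega> a x \<sigma>) = \<sigma>"
proof
  fix v
  have same: "cluster \<beta> E \<omega> a x (flip \<beta> E \<omega> a x \<sigma>) = cluster \<beta> E \<omega> a x \<sigma>"
    by (simp add: cluster_def rigid_flip[OF assms(1)])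
  have "reflect a (reflect a (\<sigma> v)) = \<sigma> v" if "v \<in> cluster \<beta> E \<omega> a x \<sigma>"
  proof -
    have "v \<in> V"
      using that cluster_subset[OF assms(2,3)] by blast
    then have "\<sigma> v \<in> spins q"
      using assms(4) by (auto simp: configs_def)
    then show ?thesis
      using reflect_reflect spins_bounds by blast
  qed
  then show "flip \<beta> E \<omega> a x (flip \<beta> E \<omega> a x \<sigma>) v = \<sigma> v"
    unfolding flip_def[of \<beta> E \<omega> a x "flip \<beta> E \<omega> a x \<sigma>"] same by (simp add: flip_def)
qed

lemma finite_configs: "finite V \<Longrightarrow> finite (configs q V)"
  by (simp add: configs_def finite_PiE finite_spins)

lemma card_compatible_le:
  assumes "\<beta> > 0" "finite V" "E \<subseteq> nsets V 2" "x \<in> V" "a \<in> spins q"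
  shows "card {\<sigma> \<in> configs q V. compatible \<beta> E \<omega> \<sigma> \<and> (\<forall>u\<in>U. \<sigma> u = 0) \<and> \<sigma> x = a}
         \<le> card {\<sigma> \<in> configs q V. compatible \<beta> E \<omega> \<sigma> \<and> (\<forall>u\<in>U. \<sigma> u = 0) \<and> \<sigma> x = 0}"
    (is "card ?A \<le> card ?B")
proof (cases "a = 0")
  case True
  then show ?thesis by simp
next
  case False
  have "0 < a / 2" "a / 2 < pi"
    using False spins_bounds[OF assms(5)] by auto
  then have pos: "sin (a / 2) > 0"
    by (rule sin_gt_zero)
  let ?f = "flip \<beta> E \<omega> a x"
  have "inj_on ?f ?A"
    using flip_flip[OF _ assms(3,4)] by (intro inj_on_inverseI[of _ ?f]) blast
  moreover have "?f ` ?A \<subseteq> ?B"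
  proof (rule image_subsetI)
    fix \<sigma> assume "\<sigma> \<in> ?A"
    then have \<sigma>: "\<sigma> \<in> configs q V" "compatible \<beta> E \<omega> \<sigma>" "\<forall>u\<in>U. \<sigma> u = 0" "\<sigma> x = a"
      by blast+
    have "?f \<sigma> u = 0" if "u \<in> U" for u
    proof -
      have "\<sigma> u = 0" using that \<sigma>(3) by blast
      then have "\<not> sin (\<sigma> u - a / 2) > 0"
        using pos by simp
      moreover have "sin (\<sigma> x - a / 2) > 0"
        using pos \<sigma>(4) by simp
      ultimately have "u \<notin> cluster \<beta> E \<omega> a x \<sigma>"
        using cluster_same_side[OF assms(1) \<sigma>(2)] by blast
      then show ?thesis using \<open>\<sigma> u = 0\<close> by (simp add: flip_def)
    qed
    moreover have "?f \<sigma> x = 0"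
      using \<sigma>(4) by (simp add: flip_def cluster_refl reflect_def)
    ultimately show "?f \<sigma> \<in> ?B"
      using flip_in_configs[OF assms(3-5) \<sigma>(1)] compatible_flip[OF \<sigma>(2)] by blast
  qed
  moreover have "finite ?B"
    using finite_configs[OF assms(2)] by simp
  ultimately show ?thesis
    by (rule card_inj_on_le)
qed

lemma prob_mu_hat:
  assumes "q > 0" "finite V" "U \<subseteq> V"
  shows "measure_pmf.prob (mu_hat q V U) {\<sigma>. \<sigma> x = b \<and> compatible \<beta> E \<omega> \<sigma>}
       = real (card {\<sigma> \<in> configs q V. compatible \<beta> E \<omega> \<sigma> \<and> (\<forall>u\<in>U. \<sigma> u = 0) \<and> \<sigma> x = b})
         / real (card {\<sigma> \<in> configs q V. \<forall>u\<in>U. \<sigma> u = 0})"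
proof -
  let ?S = "{\<sigma> \<in> configs q V. \<forall>u\<in>U. \<sigma> u = 0}"
  have "finite ?S"
    using finite_configs[OF assms(2)] by simp
  moreover have "?S \<noteq> {}"
    unfolding vanishing_configs_eq_PiE[OF assms(1,3)] PiE_eq_empty_iff
    using zero_in_spins[OF assms(1)] by auto
  moreover have "?S \<inter> {\<sigma>. \<sigma> x = b \<and> compatible \<beta> E \<omega> \<sigma>}
      = {\<sigma> \<in> configs q V. compatible \<beta> E \<omega> \<sigma> \<and> (\<forall>u\<in>U. \<sigma> u = 0) \<and> \<sigma> x = b}"
    by blast
  ultimately show ?thesis
    by (simp add: mu_hat_def measure_pmf_of_set)
qed

theorem lemma2p4:
  fixes q :: nat and \<beta> :: real
    and V U :: "'v set" and E :: "'v set set"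
    and x :: 'v and a :: real and \<omega> :: "'v set \<Rightarrow> real"
  assumes "q \<ge> 2" and "\<beta> > 0"
    and "finite V" and "E \<subseteq> nsets V 2"
    and "U \<subseteq> V" and "U \<noteq> {}" and "\<forall>u\<in>U. \<forall>v\<in>U. {u, v} \<notin> E"
    and "x \<in> V" and "a \<in> spins q" and "\<omega> \<in> edge_configs q \<beta> E"
  shows "card {\<sigma> \<in> configs q V. compatible \<beta> E \<omega> \<sigma> \<and> (\<forall>u\<in>U. \<sigma> u = 0) \<and> \<sigma> x = a}
         \<le> card {\<sigma> \<in> configs q V. compatible \<beta> E \<omega> \<sigma> \<and> (\<forall>u\<in>U. \<sigma> u = 0) \<and> \<sigma> x = 0}
       \<and> measure_pmf.prob (mu_hat q V U) {\<sigma>. \<sigma> x = a \<and> compatible \<beta> E \<omega> \<sigma>}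
         \<le> measure_pmf.prob (mu_hat q V U) {\<sigma>. \<sigma> x = 0 \<and> compatible \<beta> E \<omega> \<sigma>}"
proof -
  have "q > 0" using assms(1) by simp
  note prob = prob_mu_hat[OF this assms(3,5)]
  note le = card_compatible_le[OF assms(2-4,8,9), of \<omega> U]
  show ?thesis
    unfolding prob using le by (simp add: divide_right_mono)
qed

end
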